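(* For $n\ge1$, the constants $a_n,b_n,c_n$ in the three term relation $$zX_{-n}(z)=a_nX_{-n}(z)+b_nX_n(z)+c_nX_{n-1}(z)$$ are $$a_n=\frac{\big(-t_1-t_2+t_1t_2(t_3+t_4)q^{n-1}\big)\big(1-t_1t_2t_3t_4q^{2n-1}\big)}{\big(-1-t_1t_2+t_1t_2t_3t_4q^{n-1}+t_1t_2q^n\big)\big(1-t_1t_2t_3t_4q^{2n-2}\big)},$$ $$b_n=-\frac{\big(-t_1-t_2+t_1t_2(t_3+t_4)q^{n-1}\big)\big(1-t_1t_2t_3t_4q^{n-1}\big)\big(1-t_3t_4q^{n-1}\big)}{\big(-1-t_1t_2+t_1t_2t_3t_4q^{n-1}+t_1t_2q^n\big)\big(1-t_1t_2t_3t_4q^{2n-2}\big)},$$ $$c_n=\frac{t_1\big(1-t_3t_4q^{n-1}\big)\big(1-t_2t_4q^{n-1}\big)\big(1-t_2t_3q^{n-1}\big)}{\big(1-t_1t_2q^{n-1}\big)\big(1-t_1t_2t_3t_4q^{2n-2}\big)}.$$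
   Context: Standing assumptions: $0<q<1$; $\mathbf t=(t_1,t_2,t_3,t_4)$ with each $t_i$ real and $|t_i|<1$. Notation: $(a;q)_k=\prod_{i=0}^{k-1}(1-aq^i)$, $(a_1,\dots,a_r;q)_k=\prod_j(a_j;q)_k$, and ${}_4\phi_3(a_1,a_2,a_3,a_4;b_1,b_2,b_3;q,q)=\sum_{k\ge 0}\frac{(a_1,a_2,a_3,a_4;q)_k}{(q,b_1,b_2,b_3;q)_k}q^k$. $R_n={}_4\phi_3(q^{-n},t_1t_2t_3t_4q^{n-1},t_1z,t_1/z;\;t_1t_2,t_1t_3,t_1t_4;q,q)$ for $n\ge0$; $S_0=0$ and for $n\ge1$, $S_n=z(1-t_3/z)(1-t_4/z)\;{}_4\phi_3(q^{1-n},t_1t_2t_3t_4q^{n},t_1z,qt_1/z;\;qt_1t_2,qt_1t_3,qt_1t_4;q,q)$. These are Laurent polynomials in $z$. Define the Laurent polynomials $X_{-n}=(1-t_1t_2)(1-t_1t_3)(1-t_1t_4)R_n-t_1(1-t_1t_2t_3t_4q^{n-1})S_n$ for $n>0$, $X_{n}=(1-t_1t_2)(1-t_1t_3)(1-t_1t_4)R_n+t_1^2t_2(1-q^{n})S_n$ for $n\ge0$.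
   Formalization: The common factor -1-t_1t_2+t_1t_2t_3t_4q^{n-1}+t_1t_2q^n in the denominators of a_n, b_n is assumed nonzero (it can vanish under |t_i|<1); that the constants are the only ones is claimed for t_1≠0, since X_{-n}=X_n=0 at t_1=0. *)

theory Defs
  imports "HOL-Analysis.Analysis"
begin

definition qpoch :: "complex \<Rightarrow> real \<Rightarrow> nat \<Rightarrow> complex" where
  "qpoch a q k = (\<Prod>i<k. 1 - a * of_real q ^ i)"

text \<open>The basic hypergeometric series
  \<open>\<^sub>4\<phi>\<^sub>3(a\<^sub>1,a\<^sub>2,a\<^sub>3,a\<^sub>4; b\<^sub>1,b\<^sub>2,b\<^sub>3; q,q)\<close>. It is only used below with
  \<open>a\<^sub>1 = q\<^sup>-\<^sup>m\<close> for a natural number \<open>m\<close>, where all terms with \<open>k > m\<close> vanish.\<close>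

definition phi43 ::
  "complex \<Rightarrow> complex \<Rightarrow> complex \<Rightarrow> complex \<Rightarrow> complex \<Rightarrow> complex \<Rightarrow> complex \<Rightarrow> real \<Rightarrow> complex" where
  "phi43 a1 a2 a3 a4 b1 b2 b3 q =
     (\<Sum>k. (qpoch a1 q k * qpoch a2 q k * qpoch a3 q k * qpoch a4 q k)
        / (qpoch (of_real q) q k * qpoch b1 q k * qpoch b2 q k * qpoch b3 q k) * of_real q ^ k)"

text \<open>Laurent polynomials in \<open>z\<close> are represented by the functions they define on the
  nonzero complex numbers; the value at \<open>z = 0\<close> is meaningless. Exponents such as \<open>n - 1\<close>
  may be negative (for \<open>n = 0\<close>), hence the integer powers.\<close>

definition R_poly :: "real \<Rightarrow> real \<Rightarrow> real \<Rightarrow> real \<Rightarrow> real \<Rightarrow> nat \<Rightarrow> complex \<Rightarrow> complex" where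
  "R_poly q t1 t2 t3 t4 n z =
     phi43 (of_real (q powi (- int n))) (of_real (t1 * t2 * t3 * t4 * q powi (int n - 1)))
       (of_real t1 * z) (of_real t1 / z)
       (of_real (t1 * t2)) (of_real (t1 * t3)) (of_real (t1 * t4)) q"

definition S_poly :: "real \<Rightarrow> real \<Rightarrow> real \<Rightarrow> real \<Rightarrow> real \<Rightarrow> nat \<Rightarrow> complex \<Rightarrow> complex" where
  "S_poly q t1 t2 t3 t4 n z =
     (if n = 0 then 0
      else z * (1 - of_real t3 / z) * (1 - of_real t4 / z) *
        phi43 (of_real (q powi (1 - int n))) (of_real (t1 * t2 * t3 * t4 * q ^ n))
          (of_real t1 * z) (of_real (q * t1) / z)
          (of_real (q * t1 * t2)) (of_real (q * t1 * t3)) (of_real (q * t1 * t4)) q)"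

definition X_poly :: "real \<Rightarrow> real \<Rightarrow> real \<Rightarrow> real \<Rightarrow> real \<Rightarrow> int \<Rightarrow> complex \<Rightarrow> complex" where
  "X_poly q t1 t2 t3 t4 m z =
     (let n = nat \<bar>m\<bar>;
          A = of_real ((1 - t1 * t2) * (1 - t1 * t3) * (1 - t1 * t4))
      in if m < 0
         then A * R_poly q t1 t2 t3 t4 n z
              - of_real (t1 * (1 - t1 * t2 * t3 * t4 * q powi (int n - 1))) * S_poly q t1 t2 t3 t4 n z
         else A * R_poly q t1 t2 t3 t4 n z
              + of_real (t1\<^sup>2 * t2 * (1 - q ^ n)) * S_poly q t1 t2 t3 t4 n z)"

text \<open>The relation \<open>z X\<^sub>-\<^sub>n = a X\<^sub>-\<^sub>n + b X\<^sub>n + c X\<^sub>n\<^sub>-\<^sub>1\<close> as an identity of Laurent polynomials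
  with constant coefficients \<open>a\<close>, \<open>b\<close>, \<open>c\<close>.\<close>

definition three_term_relation ::
  "real \<Rightarrow> real \<Rightarrow> real \<Rightarrow> real \<Rightarrow> real \<Rightarrow> nat \<Rightarrow> complex \<Rightarrow> complex \<Rightarrow> complex \<Rightarrow> bool" where
  "three_term_relation q t1 t2 t3 t4 n a b c \<longleftrightarrow>
     (\<forall>z. z \<noteq> 0 \<longrightarrow>
        z * X_poly q t1 t2 t3 t4 (- int n) z =
          a * X_poly q t1 t2 t3 t4 (- int n) z + b * X_poly q t1 t2 t3 t4 (int n) z
          + c * X_poly q t1 t2 t3 t4 (int n - 1) z)"

definition coeff_a :: "real \<Rightarrow> real \<Rightarrow> real \<Rightarrow> real \<Rightarrow> real \<Rightarrow> nat \<Rightarrow> real" where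
  "coeff_a q t1 t2 t3 t4 n =
     ((- t1 - t2 + t1 * t2 * (t3 + t4) * q ^ (n - 1)) * (1 - t1 * t2 * t3 * t4 * q ^ (2 * n - 1)))
     / ((- 1 - t1 * t2 + t1 * t2 * t3 * t4 * q ^ (n - 1) + t1 * t2 * q ^ n)
        * (1 - t1 * t2 * t3 * t4 * q ^ (2 * n - 2)))"

definition coeff_b :: "real \<Rightarrow> real \<Rightarrow> real \<Rightarrow> real \<Rightarrow> real \<Rightarrow> nat \<Rightarrow> real" where
  "coeff_b q t1 t2 t3 t4 n =
     - (((- t1 - t2 + t1 * t2 * (t3 + t4) * q ^ (n - 1)) * (1 - t1 * t2 * t3 * t4 * q ^ (n - 1))
          * (1 - t3 * t4 * q ^ (n - 1)))
        / ((- 1 - t1 * t2 + t1 * t2 * t3 * t4 * q ^ (n - 1) + t1 * t2 * q ^ n)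
           * (1 - t1 * t2 * t3 * t4 * q ^ (2 * n - 2))))"

definition coeff_c :: "real \<Rightarrow> real \<Rightarrow> real \<Rightarrow> real \<Rightarrow> real \<Rightarrow> nat \<Rightarrow> real" where
  "coeff_c q t1 t2 t3 t4 n =
     (t1 * (1 - t3 * t4 * q ^ (n - 1)) * (1 - t2 * t4 * q ^ (n - 1)) * (1 - t2 * t3 * q ^ (n - 1)))
     / ((1 - t1 * t2 * q ^ (n - 1)) * (1 - t1 * t2 * t3 * t4 * q ^ (2 * n - 2)))"

end

theory Submission
  imports Defs
begin

text \<open>Put \<open>M = q\<^sup>n\<^sup>-\<^sup>1\<close>, \<open>T = t\<^sub>1t\<^sub>2t\<^sub>3t\<^sub>4\<close>, \<open>D = 1 - TM\<^sup>2\<close>,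
  \<open>g = t\<^sub>1 + t\<^sub>2 - t\<^sub>1t\<^sub>2(t\<^sub>3 + t\<^sub>4)M\<close> and let \<open>A\<close> be the constant factor of \<open>R\<^sub>n\<close> in \<open>X\<^sub>n\<close>.
  In \<open>a\<^sub>nX\<^sub>-\<^sub>n + b\<^sub>nX\<^sub>n\<close> the first factor of the denominator cancels, leaving
  \<open>(g/D)(A M t\<^sub>3t\<^sub>4 R\<^sub>n - t\<^sub>1(1 - TM) S\<^sub>n)\<close>. The relation becomes the vanishing of a linear
  combination of four terminating series. With the terms of \<open>S\<^sub>n\<close> and \<open>S\<^sub>n\<^sub>-\<^sub>1\<close> shifted by one
  against those of \<open>R\<^sub>n\<close> and \<open>R\<^sub>n\<^sub>-\<^sub>1\<close>, its partial sums have a closed form containing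
  \<open>(1/M;q)\<^sub>j\<close>, which is zero at \<open>j = n\<close>.

  For uniqueness, compare the coefficients of \<open>z\<^sup>n\<close> and \<open>z\<^sup>-\<^sup>n\<close>: they are equal in \<open>R\<^sub>n\<close>, have
  ratio \<open>1 : t\<^sub>3t\<^sub>4M \<noteq> 1\<close> in \<open>S\<^sub>n\<close>, and vanish in \<open>X\<^sub>n\<^sub>-\<^sub>1\<close>; moreover \<open>X\<^sub>n\<^sub>-\<^sub>1(1/t\<^sub>1) \<noteq> 0\<close>.\<close>

section \<open>q-shifted factorials and terminating series\<close>

lemma qpoch_0 [simp]: "qpoch a q 0 = 1"
  by (simp add: qpoch_def)

lemma qpoch_Suc: "qpoch a q (Suc k) = qpoch a q k * (1 - a * of_real q ^ k)"
  by (simp add: qpoch_def)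

lemma qpoch_Suc_shift: "qpoch a q (Suc k) = (1 - a) * qpoch (of_real q * a) q k"
  unfolding qpoch_def prod.lessThan_Suc_shift by (simp add: mult_ac)

lemma qpoch_eq_0_iff: "qpoch a q k = 0 \<longleftrightarrow> (\<exists>i<k. a * of_real q ^ i = 1)"
  by (auto simp: qpoch_def)

lemma abs_mult_less_1:
  fixes a b :: real
  assumes "\<bar>a\<bar> < 1" "\<bar>b\<bar> \<le> 1"
  shows "\<bar>a * b\<bar> < 1"
  using mult_left_mono[of "\<bar>b\<bar>" 1 "\<bar>a\<bar>"] assms by (simp add: abs_mult)

text \<open>Keeps the series free of zero denominators: their lower parameters are \<open>q\<close>
  and products of \<open>t1\<close> with another \<open>ti\<close>, possibly times
  \<open>q\<close>.\<close>

lemma qpoch_of_real_nonzero: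
  assumes "\<bar>q\<bar> \<le> 1" "\<bar>a\<bar> < 1"
  shows "qpoch (of_real a) q k \<noteq> 0"
proof
  assume "qpoch (of_real a) q k = 0"
  then obtain i where "of_real (a * q ^ i) = (1::complex)"
    by (auto simp: qpoch_eq_0_iff)
  then have "a * q ^ i = 1"
    by (simp only: of_real_eq_1_iff)
  moreover have "\<bar>a * q ^ i\<bar> < 1"
    using assms by (intro abs_mult_less_1) (simp_all add: power_abs power_le_one)
  ultimately show False by simp
qed

definition phi43_term ::
  "complex \<Rightarrow> complex \<Rightarrow> complex \<Rightarrow> complex \<Rightarrow> complex \<Rightarrow> complex \<Rightarrow> complex \<Rightarrow> real \<Rightarrow> nat \<Rightarrow> complex" where
  "phi43_term a1 a2 a3 a4 b1 b2 b3 q k =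
     (qpoch a1 q k * qpoch a2 q k * qpoch a3 q k * qpoch a4 q k)
        / (qpoch (of_real q) q k * qpoch b1 q k * qpoch b2 q k * qpoch b3 q k) * of_real q ^ k"

text \<open>A vanishing factor of \<open>qpoch a1 q N\<close> persists in all longer products. Any
  such \<open>N\<close> is allowed, so that series of different degree can be given the same
  summation range.\<close>

lemma phi43_terminating:
  assumes "qpoch a1 q N = 0"
  shows "phi43 a1 a2 a3 a4 b1 b2 b3 q = (\<Sum>k<N. phi43_term a1 a2 a3 a4 b1 b2 b3 q k)"
  unfolding phi43_def phi43_term_def
proof (rule suminf_finite)
  fix k assume "k \<notin> {..<N}"
  then have "N \<le> k" by simp
  with assms have "qpoch a1 q k = 0"
    unfolding qpoch_eq_0_iff by (meson less_le_trans)
  then show "qpoch a1 q k * qpoch a2 q k * qpoch a3 q k * qpoch a4 q k /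
      (qpoch (of_real q) q k * qpoch b1 q k * qpoch b2 q k * qpoch b3 q k) * of_real q ^ k = 0"
    by simp
qed simp

section \<open>Telescoping of the four series\<close>

text \<open>The numerator of the telescoping step is affine in \<open>C = c\<^sub>nD\<close>; its two coefficients have the
  common factor \<open>r\<close>, so that it vanishes for the given value of \<open>c\<^sub>n\<close>.\<close>

lemma telescope_identity_C:
  fixes t1 t2 t3 t4 z M q x T P r :: complex
  assumes "T = t1 * t2 * t3 * t4" "P = (1 - t1*t2*x) * (1 - t1*t3*x) * (1 - t1*t4*x)"
    and "r = - x * z * (1 - q*x) * (1 - t1*z*x + t1*M * (z - t3 - t4 + t1*t3*t4*x))"
  shows "- (M - x) * (q - T*M) * (z - t1) * (1 - t1*z*x) * x
           - x * (1 - q*x) * M * t1^2 * t2 * (z - t3) * (z - t4) * (x - M)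
           - P * z * M * (1 - q*x)
           + (M - x) * (1 - T*M*x) * (1 - t1*z*x) * (z - q*x*t1)
         = (1 - t1*t2*M) * r"
  unfolding assms by algebra

lemma telescope_identity_0:
  fixes t1 t2 t3 t4 z M q x T P r D g :: complex
  assumes "T = t1 * t2 * t3 * t4" "P = (1 - t1*t2*x) * (1 - t1*t3*x) * (1 - t1*t4*x)"
    and "r = - x * z * (1 - q*x) * (1 - t1*z*x + t1*M * (z - t3 - t4 + t1*t3*t4*x))"
    and "D = 1 - T * M^2" "g = t1 + t2 - t1*t2 * (t3 + t4) * M"
  shows "(z*D - g*M*t3*t4) * (q*M - 1) * (1 - T*M*x) * (z - t1) * (1 - t1*z*x) * x
           - x * (1 - q*x) * M * t1 * (z*D - g) * (z - t3) * (z - t4) * (1 - T*M*x)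
           + P * (z*D - g*M*t3*t4) * z * M * (1 - q*x)
           - (M - x) * (1 - T*M*x) * (1 - t1*z*x) * (z - q*x*t1) * (z*D - g*M*t3*t4)
         = - t1 * (1 - t3*t4*M) * (1 - t2*t4*M) * (1 - t2*t3*M) * r"
  unfolding assms by algebra

text \<open>One step of the telescoping sum, with \<open>x = q\<^sup>j\<close>.\<close>

lemma telescope_step:
  fixes t1 t2 t3 t4 z M q x T P D g C L :: complex
  assumes T: "T = t1 * t2 * t3 * t4" and P: "P = (1 - t1*t2*x) * (1 - t1*t3*x) * (1 - t1*t4*x)"
    and D: "D = 1 - T * M^2" and g: "g = t1 + t2 - t1*t2 * (t3 + t4) * M"
    and C: "C * (1 - t1*t2*M) = t1 * (1 - t3*t4*M) * (1 - t2*t4*M) * (1 - t2*t3*M)"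
    and L: "L = z*D - g*M*t3*t4 - C"
    and nz: "z \<noteq> 0" "M \<noteq> 0" "x \<noteq> 0" "q \<noteq> 0" "1 - q*x \<noteq> 0"
  shows "P * L / x
      + (z*D - g*M*t3*t4) * ((1 - 1/(q*M)) * (1 - T*M*x) * (1 - t1/z) * (1 - t1*z*x) * q / (1 - q*x))
      - C * ((1 - 1/M*x) * (1 - T*M/q) * (1 - t1/z) * (1 - t1*z*x) * q / (1 - q*x))
      - t1 * (z*D - g) * (z * (1 - t3/z) * (1 - t4/z)) * (1 - T*M*x)
      - C * t1^2 * t2 * (z * (1 - t3/z) * (1 - t4/z)) * (x - M)
      = (1 - 1/M*x) * (1 - T*M*x) * (1 - t1*z*x) * (1 - q*t1/z*x) * L / (x * (1 - q*x))"
    (is "?l = ?r")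
proof -
  define r where "r = - x * z * (1 - q*x) * (1 - t1*z*x + t1*M * (z - t3 - t4 + t1*t3*t4*x))"
  \<comment> \<open>The factors become atoms, so that denominators can be cleared without expanding
    the polynomials.\<close>
  define u where "u = z*D - g*M*t3*t4"
  define w where "w = z*D - g"
  define k where "k = 1 - q*x"
  define a where "a = q*M - 1"
  define b where "b = z - t1"
  define c where "c = M - x"
  define d where "d = q - T*M"
  define e where "e = (z - t3) * (z - t4)"
  define f where "f = z - q*x*t1"
  note defs = u_def w_def k_def a_def b_def c_def d_def e_def f_def
  have frac: "1 - 1/(q*M) = a/(q*M)" "1 - t1/z = b/z" "1 - 1/M*x = c/M"
    "1 - T*M/q = d/q" "z * (1 - t3/z) * (1 - t4/z) = e/z" "1 - q*t1/z*x = f/z"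
    using nz by (simp_all add: defs field_simps)
  have "u * a * (1 - T*M*x) * b * (1 - t1*z*x) * x - x * k * M * t1 * w * e * (1 - T*M*x)
      + P * u * z * M * k - c * (1 - T*M*x) * (1 - t1*z*x) * f * u
      = - t1 * (1 - t3*t4*M) * (1 - t2*t4*M) * (1 - t2*t3*M) * r"
    using telescope_identity_0[OF T P r_def D g] by (simp only: defs mult.assoc)
  moreover have "- c * d * b * (1 - t1*z*x) * x - x * k * M * t1^2 * t2 * e * (x - M)
      - P * z * M * k + c * (1 - T*M*x) * (1 - t1*z*x) * f
      = (1 - t1*t2*M) * r"
    using telescope_identity_C[OF T P r_def] by (simp only: defs mult.assoc)
  moreover have "L = u - C"
    by (simp add: L u_def)
  \<comment> \<open>Add the first identity to \<open>C\<close> times the second. The right-hand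
    sides combine to a multiple of \<open>r\<close> whose coefficient is zero by the hypothesis on
    \<open>C\<close>.\<close>
  ultimately have num: "P * L * z * M * k + u * a * (1 - T*M*x) * b * (1 - t1*z*x) * x
      - C * c * d * b * (1 - t1*z*x) * x - t1 * w * e * (1 - T*M*x) * x * k * M
      - C * t1^2 * t2 * e * (x - M) * x * k * M
      = c * (1 - T*M*x) * (1 - t1*z*x) * f * L"
    using C by algebra
  have k: "k \<noteq> 0"
    using nz by (simp add: k_def)
  define h where "h = 1 - T*M*x"
  define l where "l = 1 - t1*z*x"
  define m where "m = x - M"
  have "?l = P * L / x + u * (a/(q*M) * h * (b/z) * l * q / k) - C * (c/M * (d/q) * (b/z) * l * q / k)
      - t1 * w * (e/z) * h - C * t1^2 * t2 * (e/z) * m"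
    unfolding frac by (simp only: u_def w_def k_def h_def l_def m_def)
  also have "\<dots> = (P * L * z * M * k + u * a * h * b * l * x
      - C * c * d * b * l * x - t1 * w * e * h * x * k * M
      - C * t1^2 * t2 * e * m * x * k * M) / (z * M * x * k)"
    using nz k by (simp add: add_divide_distrib diff_divide_distrib mult_ac)
  also have "\<dots> = ?r"
    unfolding num[folded h_def l_def m_def] frac k_def[symmetric] h_def[symmetric] l_def[symmetric]
    using nz k by simp
  finally show ?thesis .
qed

text \<open>For \<open>M\<close> equal to q^(n-1) the sums belong to R_n, R_(n-1), S_n and S_(n-1),
  in this order. Term \<open>Suc j\<close> of an R series and term \<open>j\<close> of an S series
  are the same \<open>B j\<close> times a rational function of \<open>Q^j\<close>, once
  \<open>A\<close>, \<open>1 - T*M\<close> and \<open>1 - M\<close> have absorbed the parameter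
  shifts; hence the different lengths of the sums. The induction step is
  \<open>telescope_step\<close> times \<open>B j\<close>.\<close>

lemma phi43_terms_telescope:
  fixes t1 t2 t3 t4 z M Q T D g C L A Z :: complex and q :: real
  assumes T: "T = t1 * t2 * t3 * t4"
    and D: "D = 1 - T * M^2" and g: "g = t1 + t2 - t1*t2 * (t3 + t4) * M"
    and C: "C * (1 - t1*t2*M) = t1 * (1 - t3*t4*M) * (1 - t2*t4*M) * (1 - t2*t3*M)"
    and L: "L = z*D - g*M*t3*t4 - C"
    and Q: "Q = of_real q"
    and A: "A = (1 - t1*t2) * (1 - t1*t3) * (1 - t1*t4)"
    and Z: "Z = z * (1 - t3/z) * (1 - t4/z)"
    and nz: "z \<noteq> 0" "M \<noteq> 0" "Q \<noteq> 0"
    and den: "\<And>k. qpoch Q q k \<noteq> 0" "\<And>k. qpoch (t1*t2) q k \<noteq> 0"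
      "\<And>k. qpoch (t1*t3) q k \<noteq> 0" "\<And>k. qpoch (t1*t4) q k \<noteq> 0"
  defines "B \<equiv> phi43_term (1/M) (T*M) (t1*z) (Q*t1/z) (Q*t1*t2) (Q*t1*t3) (Q*t1*t4) q"
  shows "(z*D - g*M*t3*t4) * A
           * (\<Sum>k<Suc j. phi43_term (1/(Q*M)) (T*M) (t1*z) (t1/z) (t1*t2) (t1*t3) (t1*t4) q k)
      - C * A * (\<Sum>k<Suc j. phi43_term (1/M) (T*M/Q) (t1*z) (t1/z) (t1*t2) (t1*t3) (t1*t4) q k)
      - t1 * (1 - T*M) * (z*D - g) * Z
          * (\<Sum>k<j. phi43_term (1/M) (Q*T*M) (t1*z) (Q*t1/z) (Q*t1*t2) (Q*t1*t3) (Q*t1*t4) q k)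
      - C * t1^2 * t2 * (1 - M) * Z
          * (\<Sum>k<j. phi43_term (Q/M) (T*M) (t1*z) (Q*t1/z) (Q*t1*t2) (Q*t1*t3) (Q*t1*t4) q k)
      = B j * ((1 - t1*t2*Q^j) * (1 - t1*t3*Q^j) * (1 - t1*t4*Q^j) * L / Q^j)"
proof (induction j)
  case 0
  show ?case by (simp add: phi43_term_def B_def A L algebra_simps)
next
  case (Suc j)
  define x where "x = Q^j"
  have x: "x \<noteq> 0" using nz by (simp add: x_def)
  have "1 - Q * x \<noteq> 0"
    using den(1)[of "Suc j"] by (simp add: qpoch_Suc Q x_def)
  have one: "1 - t1*t2 \<noteq> 0" "1 - t1*t3 \<noteq> 0" "1 - t1*t4 \<noteq> 0"
    using den(2-4)[of 1] by (simp_all add: qpoch_def)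
  have shift: "qpoch (t1*t) q (Suc k) = (1 - t1*t) * qpoch (Q*t1*t) q k" for t k
    by (simp add: qpoch_Suc_shift Q mult.assoc)
  have den': "qpoch (Q*t1*t2) q k \<noteq> 0" "qpoch (Q*t1*t3) q k \<noteq> 0" "qpoch (Q*t1*t4) q k \<noteq> 0" for k
    using den(2-4)[of "Suc k"] by (simp_all add: shift)
  have dx: "1 - t1*t2*(Q*x) \<noteq> 0" "1 - t1*t3*(Q*x) \<noteq> 0" "1 - t1*t4*(Q*x) \<noteq> 0"
    using den(2-4)[of "Suc (Suc j)"] by (simp_all add: qpoch_Suc Q x_def)
  have z1: "qpoch (t1/z) q (Suc j) = (1 - t1/z) * qpoch (Q*t1/z) q j"
    using qpoch_Suc_shift[of "t1/z" q j] by (simp add: Q)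
  have m1: "qpoch (1/(Q*M)) q (Suc j) = (1 - 1/(Q*M)) * qpoch (1/M) q j"
    using qpoch_Suc_shift[of "1/(Q*M)" q j] nz by (simp add: Q)
  \<comment> \<open>The factor \<open>1 - M\<close> is never divided by, so the case
    \<open>M = 1\<close>, that is n = 1, is covered.\<close>
  have m2: "(1 - M) * qpoch (Q/M) q j = qpoch (1/M) q j * (x - M)"
  proof -
    have "(1 - 1/M) * qpoch (Q/M) q j = qpoch (1/M) q j * (1 - 1/M*x)"
      using qpoch_Suc_shift[of "1/M" q j] qpoch_Suc[of "1/M" q j] by (simp add: Q x_def)
    then have "- M * ((1 - 1/M) * qpoch (Q/M) q j) = - M * (qpoch (1/M) q j * (1 - 1/M*x))"
      by simp
    then show ?thesis using nz by (simp add: algebra_simps)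
  qed
  have m3: "qpoch (T*M/Q) q (Suc j) = (1 - T*M/Q) * qpoch (T*M) q j"
    using qpoch_Suc_shift[of "T*M/Q" q j] nz by (simp add: Q)
  have m4: "(1 - T*M) * qpoch (Q*T*M) q j = qpoch (T*M) q j * (1 - T*M*x)"
    using qpoch_Suc_shift[of "T*M" q j] qpoch_Suc[of "T*M" q j] by (simp add: Q x_def mult.assoc)
  have r: "A * phi43_term (1/(Q*M)) (T*M) (t1*z) (t1/z) (t1*t2) (t1*t3) (t1*t4) q (Suc j)
      = B j * ((1 - 1/(Q*M)) * (1 - T*M*x) * (1 - t1/z) * (1 - t1*z*x) * Q / (1 - Q*x))"
    unfolding phi43_term_def B_def shift[of t2] shift[of t3] shift[of t4] z1 m1 A
    using one by (simp add: qpoch_Suc Q x_def mult_ac)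
  have r': "A * phi43_term (1/M) (T*M/Q) (t1*z) (t1/z) (t1*t2) (t1*t3) (t1*t4) q (Suc j)
      = B j * ((1 - 1/M*x) * (1 - T*M/Q) * (1 - t1/z) * (1 - t1*z*x) * Q / (1 - Q*x))"
    unfolding phi43_term_def B_def shift[of t2] shift[of t3] shift[of t4] z1 m3 A
    using one by (simp add: qpoch_Suc Q x_def mult_ac)
  have s: "(1 - T*M) * phi43_term (1/M) (Q*T*M) (t1*z) (Q*t1/z) (Q*t1*t2) (Q*t1*t3) (Q*t1*t4) q j
      = B j * (1 - T*M*x)"
  proof -
    have "(1 - T*M) * phi43_term (1/M) (Q*T*M) (t1*z) (Q*t1/z) (Q*t1*t2) (Q*t1*t3) (Q*t1*t4) q j
      = qpoch (1/M) q j * ((1 - T*M) * qpoch (Q*T*M) q j) * qpoch (t1*z) q j * qpoch (Q*t1/z) q j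
        / (qpoch Q q j * qpoch (Q*t1*t2) q j * qpoch (Q*t1*t3) q j * qpoch (Q*t1*t4) q j) * Q^j"
      by (simp add: phi43_term_def Q)
    then show ?thesis unfolding m4 by (simp add: phi43_term_def B_def Q)
  qed
  have s': "(1 - M) * phi43_term (Q/M) (T*M) (t1*z) (Q*t1/z) (Q*t1*t2) (Q*t1*t3) (Q*t1*t4) q j
      = B j * (x - M)"
  proof -
    have "(1 - M) * phi43_term (Q/M) (T*M) (t1*z) (Q*t1/z) (Q*t1*t2) (Q*t1*t3) (Q*t1*t4) q j
      = ((1 - M) * qpoch (Q/M) q j) * qpoch (T*M) q j * qpoch (t1*z) q j * qpoch (Q*t1/z) q j
        / (qpoch Q q j * qpoch (Q*t1*t2) q j * qpoch (Q*t1*t3) q j * qpoch (Q*t1*t4) q j) * Q^j"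
      by (simp add: phi43_term_def Q)
    then show ?thesis unfolding m2 by (simp add: phi43_term_def B_def Q)
  qed
  \<comment> \<open>The three factors at \<open>Q*x\<close> in the closed form cancel the new
    denominator factors of \<open>B (Suc j)\<close>, which leaves the right-hand side of
    \<open>telescope_step\<close>.\<close>
  have Bs: "B (Suc j) * ((1 - t1*t2*(Q*x)) * (1 - t1*t3*(Q*x)) * (1 - t1*t4*(Q*x)) * L / (Q*x))
    = B j * ((1 - 1/M*x) * (1 - T*M*x) * (1 - t1*z*x) * (1 - Q*t1/z*x) * L / (x * (1 - Q*x)))"
  proof -
    have "B (Suc j) = B j * ((1 - 1/M*x) * (1 - T*M*x) * (1 - t1*z*x) * (1 - Q*t1/z*x) * Q
       / ((1 - Q*x) * ((1 - t1*t2*(Q*x)) * (1 - t1*t3*(Q*x)) * (1 - t1*t4*(Q*x)))))"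
      unfolding B_def phi43_term_def by (simp add: qpoch_Suc Q x_def mult_ac)
    then show ?thesis using dx x nz by (simp add: mult_ac)
  qed
  have "B j * ((1 - t1*t2*x) * (1 - t1*t3*x) * (1 - t1*t4*x) * L / x)
     + (z*D - g*M*t3*t4) * (B j * ((1 - 1/(Q*M)) * (1 - T*M*x) * (1 - t1/z) * (1 - t1*z*x) * Q / (1 - Q*x)))
      - C * (B j * ((1 - 1/M*x) * (1 - T*M/Q) * (1 - t1/z) * (1 - t1*z*x) * Q / (1 - Q*x)))
      - t1 * (z*D - g) * Z * (B j * (1 - T*M*x))
      - C * t1^2 * t2 * Z * (B j * (x - M))
      = B j * ((1 - 1/M*x) * (1 - T*M*x) * (1 - t1*z*x) * (1 - Q*t1/z*x) * L / (x * (1 - Q*x)))"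
    unfolding telescope_step[OF T refl D g C L nz(1,2) x nz(3) \<open>1 - Q * x \<noteq> 0\<close>, symmetric] Z
    by (simp only: algebra_simps)
  then show ?case
    unfolding power_Suc x_def[symmetric] Bs r[symmetric] r'[symmetric] s[symmetric] s'[symmetric]
      Suc.IH[folded x_def, symmetric] sum.lessThan_Suc[of _ "Suc j"] sum.lessThan_Suc[of _ j]
    by (simp only: algebra_simps)
qed

section \<open>R_n, S_n and X_n as finite sums\<close>

lemma qpoch_inverse_power:
  assumes "q \<noteq> 0" "i < N"
  shows "qpoch (of_real (q powi (- int i))) q N = 0"
  unfolding qpoch_eq_0_iff using assms
  by (intro exI[of _ i]) (simp add: power_int_minus)

lemma R_poly_sum:
  assumes "q \<noteq> 0" "n < N"
  shows "R_poly q t1 t2 t3 t4 n z =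
     (\<Sum>k<N. phi43_term (of_real (q powi (- int n))) (of_real (t1 * t2 * t3 * t4 * q powi (int n - 1)))
       (of_real t1 * z) (of_real t1 / z) (of_real (t1 * t2)) (of_real (t1 * t3)) (of_real (t1 * t4)) q k)"
  unfolding R_poly_def by (rule phi43_terminating) (rule qpoch_inverse_power[OF assms])

text \<open>The upper parameter is q^(-(n-1)), so \<open>n\<close> terms suffice, one fewer than for
  R_n.\<close>

lemma S_poly_sum:
  assumes "q \<noteq> 0" "0 < n" "n \<le> N"
  shows "S_poly q t1 t2 t3 t4 n z = z * (1 - of_real t3 / z) * (1 - of_real t4 / z) *
     (\<Sum>k<N. phi43_term (of_real (q powi (1 - int n))) (of_real (t1 * t2 * t3 * t4 * q ^ n))
       (of_real t1 * z) (of_real (q * t1) / z)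
       (of_real (q * t1 * t2)) (of_real (q * t1 * t3)) (of_real (q * t1 * t4)) q k)"
proof -
  have "1 - int n = - int (n - 1)" using assms by simp
  then have "qpoch (of_real (q powi (1 - int n))) q N = 0"
    using qpoch_inverse_power[of q "n - 1" N] assms by simp
  then show ?thesis
    using assms by (simp add: S_poly_def phi43_terminating)
qed

lemma X_poly_neg:
  "n > 0 \<Longrightarrow> X_poly q t1 t2 t3 t4 (- int n) z =
     of_real ((1 - t1 * t2) * (1 - t1 * t3) * (1 - t1 * t4)) * R_poly q t1 t2 t3 t4 n z
     - of_real (t1 * (1 - t1 * t2 * t3 * t4 * q ^ (n - 1))) * S_poly q t1 t2 t3 t4 n z"
  by (simp add: X_poly_def power_int_def nat_diff_distrib)

lemma X_poly_nonneg:
  "X_poly q t1 t2 t3 t4 (int n) z =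
     of_real ((1 - t1 * t2) * (1 - t1 * t3) * (1 - t1 * t4)) * R_poly q t1 t2 t3 t4 n z
     + of_real (t1\<^sup>2 * t2 * (1 - q ^ n)) * S_poly q t1 t2 t3 t4 n z"
  by (simp add: X_poly_def)

section \<open>Validity of the three term relation\<close>

text \<open>This is the coefficient of A R_n in a_n X_(-n) + b_n X_n, where \<open>E\<close> and
  \<open>g\<close> are the negatives of the corresponding factors of a_n and b_n. Up to
  \<open>g\<close>, the two numerators differ by \<open>M*t3*t4*E\<close>, so \<open>E\<close>
  cancels.\<close>

lemma combination_R_coeff:
  fixes t1 t2 t3 t4 M q E D g :: "'a::field"
  assumes "E = 1 + t1*t2 - t1*t2*t3*t4*M - t1*t2*(q*M)" "D = 1 - t1*t2*t3*t4*M^2" "E \<noteq> 0" "D \<noteq> 0"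
  shows "g * (1 - t1*t2*t3*t4*(q*M^2)) / (E * D) - g * (1 - t1*t2*t3*t4*M) * (1 - t3*t4*M) / (E * D)
    = g * M * t3 * t4 / D"
proof -
  have "(1 - t1*t2*t3*t4*(q*M^2)) - (1 - t1*t2*t3*t4*M) * (1 - t3*t4*M) = M*t3*t4*E"
    unfolding assms(1) by algebra
  then have "g * (1 - t1*t2*t3*t4*(q*M^2)) - g * (1 - t1*t2*t3*t4*M) * (1 - t3*t4*M) = g*M*t3*t4*E"
    by algebra
  then show ?thesis
    using assms(3,4) by (simp add: diff_divide_distrib[symmetric])
qed

text \<open>This is minus the coefficient of S_n in the same combination. After the common factors
  are taken out, what remains of the numerator is exactly \<open>E\<close>.\<close>

lemma combination_S_coeff:
  fixes t1 t2 t3 t4 M q E D g :: "'a::field"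
  assumes "E = 1 + t1*t2 - t1*t2*t3*t4*M - t1*t2*(q*M)" "D = 1 - t1*t2*t3*t4*M^2" "E \<noteq> 0" "D \<noteq> 0"
  shows "t1 * (1 - t1*t2*t3*t4*M) * (g * (1 - t1*t2*t3*t4*(q*M^2)) / (E * D))
    + t1^2 * t2 * (1 - q*M) * (g * (1 - t1*t2*t3*t4*M) * (1 - t3*t4*M) / (E * D))
    = g * t1 * (1 - t1*t2*t3*t4*M) / D"
proof -
  have "(1 - t1*t2*t3*t4*(q*M^2)) + t1*t2 * (1 - q*M) * (1 - t3*t4*M) = E"
    unfolding assms(1) by algebra
  moreover have "t1 * (1 - t1*t2*t3*t4*M) * (g * (1 - t1*t2*t3*t4*(q*M^2)))
    + t1^2 * t2 * (1 - q*M) * (g * (1 - t1*t2*t3*t4*M) * (1 - t3*t4*M))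
    = g * t1 * (1 - t1*t2*t3*t4*M)
      * ((1 - t1*t2*t3*t4*(q*M^2)) + t1*t2 * (1 - q*M) * (1 - t3*t4*M))"
    by algebra
  ultimately have "t1 * (1 - t1*t2*t3*t4*M) * (g * (1 - t1*t2*t3*t4*(q*M^2)))
    + t1^2 * t2 * (1 - q*M) * (g * (1 - t1*t2*t3*t4*M) * (1 - t3*t4*M))
    = g * t1 * (1 - t1*t2*t3*t4*M) * E"
    by simp
  then show ?thesis
    using assms(3,4) by (simp add: add_divide_distrib[symmetric])
qed

lemma three_term_relation_coeffs:
  fixes q t1 t2 t3 t4 :: real and n :: nat
  assumes q: "0 < q" "q < 1"
    and t: "\<bar>t1\<bar> < 1" "\<bar>t2\<bar> < 1" "\<bar>t3\<bar> < 1" "\<bar>t4\<bar> < 1"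
    and n: "n \<ge> 1"
    and E: "- 1 - t1 * t2 + t1 * t2 * t3 * t4 * q ^ (n - 1) + t1 * t2 * q ^ n \<noteq> 0"
  shows "three_term_relation q t1 t2 t3 t4 n
           (of_real (coeff_a q t1 t2 t3 t4 n)) (of_real (coeff_b q t1 t2 t3 t4 n))
           (of_real (coeff_c q t1 t2 t3 t4 n))"
  unfolding three_term_relation_def
proof (intro allI impI)
  fix z :: complex assume z: "z \<noteq> 0"
  define m where "m = q ^ (n - 1)"
  have m: "m > 0" "m \<le> 1" using q by (simp_all add: m_def power_le_one)
  have qn: "q ^ n = q * m"
    using n by (cases n) (simp_all add: m_def)
  have q2n: "q ^ (2 * n - 2) = m^2"
    using n by (cases n) (simp_all add: m_def power_mult[symmetric] mult.commute)
  have q2n1: "q ^ (2 * n - 1) = q * m^2"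
    using n by (cases n) (simp_all add: m_def power_mult[symmetric] mult.commute)
  have small: "1 - a * y \<noteq> 0" if "\<bar>a\<bar> < 1" "0 < y" "y \<le> 1" for a y :: real
    using abs_mult_less_1[of a y] that by auto
  note prods = abs_mult_less_1 t less_imp_le[OF t(2)] less_imp_le[OF t(3)] less_imp_le[OF t(4)]
  define d where "d = 1 - t1*t2*t3*t4*m^2"
  have "d \<noteq> 0"
    unfolding d_def using m by (intro small prods) (simp_all add: power_le_one)
  have c0: "1 - t1*t2*m \<noteq> 0"
    using m by (intro small prods)
  define e where "e = 1 + t1*t2 - t1*t2*t3*t4*m - t1*t2*(q*m)"
  have "e \<noteq> 0" using E unfolding e_def qn m_def[symmetric] by auto
  define g where "g = t1 + t2 - t1*t2*(t3 + t4)*m"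
  have ne: "- 1 - t1*t2 + t1*t2*t3*t4*m + t1*t2*(q*m) = - e"
    "- t1 - t2 + t1*t2*(t3 + t4)*m = - g"
    by (simp_all add: e_def g_def)
  define a where "a = g * (1 - t1*t2*t3*t4*(q*m^2)) / (e * d)"
  \<comment> \<open>\<open>b\<close> has the opposite sign of \<open>coeff_b\<close>; the relation
    therefore appears below with \<open>- bc\<close>.\<close>
  define b where "b = g * (1 - t1*t2*t3*t4*m) * (1 - t3*t4*m) / (e * d)"
  define c where "c = coeff_c q t1 t2 t3 t4 n"
  have a: "coeff_a q t1 t2 t3 t4 n = a"
    unfolding coeff_a_def a_def m_def[symmetric] qn q2n q2n1 ne d_def[symmetric] by simp
  have b: "coeff_b q t1 t2 t3 t4 n = - b"
    unfolding coeff_b_def b_def m_def[symmetric] qn q2n q2n1 ne d_def[symmetric] by simp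
  have c: "c * d * (1 - t1*t2*m) = t1 * (1 - t3*t4*m) * (1 - t2*t4*m) * (1 - t2*t3*m)"
    unfolding c_def coeff_c_def m_def[symmetric] q2n d_def[symmetric]
    using c0 \<open>d \<noteq> 0\<close> by simp
  have ab1: "(a - b) * d = g * m * t3 * t4"
    using combination_R_coeff[OF e_def d_def \<open>e \<noteq> 0\<close> \<open>d \<noteq> 0\<close>, of g] \<open>d \<noteq> 0\<close>
    by (simp add: a_def b_def)
  have ab2: "(t1 * (1 - t1*t2*t3*t4*m) * a + t1^2 * t2 * (1 - q*m) * b) * d
     = g * t1 * (1 - t1*t2*t3*t4*m)"
    using combination_S_coeff[OF e_def d_def \<open>e \<noteq> 0\<close> \<open>d \<noteq> 0\<close>, of g] \<open>d \<noteq> 0\<close>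
    by (simp add: a_def b_def)

  define t1c t2c t3c t4c mc qc gc dc cc ac bc where cs: "t1c = complex_of_real t1"
    "t2c = complex_of_real t2" "t3c = complex_of_real t3" "t4c = complex_of_real t4"
    "mc = complex_of_real m" "qc = complex_of_real q" "gc = complex_of_real g"
    "dc = complex_of_real d" "cc = complex_of_real c" "ac = complex_of_real a"
    "bc = complex_of_real b"
  define A :: complex where "A = of_real ((1 - t1 * t2) * (1 - t1 * t3) * (1 - t1 * t4))"
  define R where "R = R_poly q t1 t2 t3 t4 n z"
  define S where "S = S_poly q t1 t2 t3 t4 n z"
  define R' where "R' = R_poly q t1 t2 t3 t4 (n - 1) z"
  define S' where "S' = S_poly q t1 t2 t3 t4 (n - 1) z"
  define Z where "Z = z * (1 - t3c / z) * (1 - t4c / z)"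
  define T :: complex where "T = t1c * t2c * t3c * t4c"
  have n_pow: "q powi (- int n) = 1 / (q * m)" "q powi (int n - 1) = m"
    "q powi (- int (n - 1)) = 1 / m" "q powi (int (n - 1) - 1) = m / q" "q powi (1 - int n) = 1 / m"
    using q n qn by (simp_all add: m_def power_int_minus power_int_diff of_nat_diff power2_eq_square field_simps)
  \<comment> \<open>Both R sums get \<open>Suc n\<close> terms and both S sums \<open>n\<close>
    terms, as the telescoping lemma at \<open>j = n\<close> requires. The surplus terms of R_(n-1)
    and S_(n-1) vanish.\<close>
  have R: "R = (\<Sum>k<Suc n. phi43_term (1/(qc * mc)) (T * mc) (t1c * z)
      (t1c / z) (t1c * t2c) (t1c * t3c) (t1c * t4c) q k)"
    using R_poly_sum[of q n "Suc n" t1 t2 t3 t4 z] q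
    unfolding R_def n_pow T_def by (simp add: cs)
  have R': "R' = (\<Sum>k<Suc n. phi43_term (1/mc) (T * mc / qc) (t1c * z)
      (t1c / z) (t1c * t2c) (t1c * t3c) (t1c * t4c) q k)"
    using R_poly_sum[of q "n - 1" "Suc n" t1 t2 t3 t4 z] q
    unfolding R'_def n_pow T_def by (simp add: cs)
  have S: "S = Z * (\<Sum>k<n. phi43_term (1/mc) (qc * T * mc) (t1c * z)
      (qc * t1c / z) (qc * t1c * t2c)
      (qc * t1c * t3c) (qc * t1c * t4c) q k)"
    using S_poly_sum[of q n n t1 t2 t3 t4 z] q n
    unfolding S_def n_pow T_def Z_def qn by (simp add: cs mult_ac)
  \<comment> \<open>For n = 1 the series formula does not describe S_0, which is 0 by definition,
    but then \<open>1 - mc\<close> is 0 as well. The factor is available because S_(n-1) enters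
    X_(n-1) only multiplied by it.\<close>
  have S': "(1 - mc) * S' = (1 - mc) * (Z * (\<Sum>k<n. phi43_term (qc/mc)
      (T * mc) (t1c * z)
      (qc * t1c / z) (qc * t1c * t2c)
      (qc * t1c * t3c) (qc * t1c * t4c) q k))"
  proof (cases "n = 1")
    case True
    then show ?thesis by (simp add: m_def cs)
  next
    case False
    then obtain k where k: "n = Suc (Suc k)"
      using n by (cases n; cases "n - 1") auto
    have "q powi (1 - int (n - 1)) = q / m"
      using q by (simp add: m_def k power_int_minus field_simps)
    then show ?thesis
      using S_poly_sum[of q "n - 1" n t1 t2 t3 t4 z] q n False
      unfolding S'_def m_def[symmetric] T_def Z_def by (simp add: cs)
  qed

  have dc: "dc = 1 - T * mc^2" by (simp add: T_def cs d_def)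
  have gc: "gc = t1c + t2c - t1c * t2c * (t3c + t4c) * mc" by (simp add: cs g_def)
  have C: "cc * dc * (1 - t1c*t2c*mc) = t1c * (1 - t3c*t4c*mc) * (1 - t2c*t4c*mc) * (1 - t2c*t3c*mc)"
    using arg_cong[OF c, of complex_of_real] by (simp add: cs)
  have Ac: "A = (1 - t1c*t2c) * (1 - t1c*t3c) * (1 - t1c*t4c)" by (simp add: A_def cs)
  have "qpoch (1/mc) q n = 0"
    using qpoch_inverse_power[of q "n - 1" n] q n unfolding n_pow(3) by (simp add: cs)
  then have B0: "phi43_term (1/mc) (T*mc) (t1c*z) (qc*t1c/z) (qc*t1c*t2c) (qc*t1c*t3c) (qc*t1c*t4c) q n = 0"
    by (simp add: phi43_term_def)
  have nz: "mc \<noteq> 0" "qc \<noteq> 0" using m q by (simp_all add: cs)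
  have den: "qpoch qc q k \<noteq> 0"
    "\<bar>y\<bar> < 1 \<Longrightarrow> qpoch (t1c * complex_of_real y) q k \<noteq> 0" for y k
    using qpoch_of_real_nonzero[of q q k] qpoch_of_real_nonzero[of q "t1 * y" k] q t abs_mult_less_1[of t1 y]
    by (simp_all add: cs)
  have main: "(z*dc - gc*mc*t3c*t4c) * A * R - cc * dc * A * R'
      - t1c * (1 - T*mc) * (z*dc - gc) * S - cc * dc * t1c^2 * t2c * ((1 - mc) * S') = 0"
    unfolding R R' S S'
    using phi43_terms_telescope[OF T_def dc gc C refl cs(6) Ac Z_def z nz den(1) den(2)[OF t(2), folded cs]
        den(2)[OF t(3), folded cs] den(2)[OF t(4), folded cs], of n, unfolded B0 mult_zero_left]
    by (simp only: mult.assoc)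
  have ab1': "(ac - bc) * dc = gc * mc * t3c * t4c"
    using arg_cong[OF ab1, of complex_of_real] by (simp add: cs)
  have ab2': "(t1c * (1 - T*mc) * ac + t1c^2 * t2c * (1 - qc*mc) * bc) * dc = gc * t1c * (1 - T*mc)"
    using arg_cong[OF ab2, of complex_of_real] by (simp add: cs T_def)
  \<comment> \<open>Multiplication by \<open>dc\<close> clears the denominators of a_n and b_n and
    produces the product \<open>cc * dc\<close> that plays the role of \<open>C\<close> in the
    telescoping.\<close>
  have "dc * (z * (A * R - t1c * (1 - T*mc) * S)) = dc * (ac * (A * R - t1c * (1 - T*mc) * S)
     - bc * (A * R + t1c^2 * t2c * (1 - qc*mc) * S) + cc * (A * R' + t1c^2 * t2c * (1 - mc) * S'))"
    using main ab1' ab2' by algebra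
  moreover have "dc \<noteq> 0" using \<open>d \<noteq> 0\<close> by (simp add: cs)
  ultimately have fin: "z * (A * R - t1c * (1 - T*mc) * S) = ac * (A * R - t1c * (1 - T*mc) * S)
     - bc * (A * R + t1c^2 * t2c * (1 - qc*mc) * S) + cc * (A * R' + t1c^2 * t2c * (1 - mc) * S')"
    by simp
  have "X_poly q t1 t2 t3 t4 (- int n) z = A * R - t1c * (1 - T*mc) * S"
    using n unfolding A_def R_def S_def T_def cs m_def by (subst X_poly_neg) simp_all
  moreover have "X_poly q t1 t2 t3 t4 (int n) z = A * R + t1c^2 * t2c * (1 - qc*mc) * S"
    unfolding X_poly_nonneg A_def R_def S_def cs qn by simp
  moreover have "X_poly q t1 t2 t3 t4 (int n - 1) z = A * R' + t1c^2 * t2c * (1 - mc) * S'"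
  proof -
    have "int n - 1 = int (n - 1)" using n by simp
    then show ?thesis
      unfolding A_def R'_def S'_def cs m_def by (simp only: X_poly_nonneg) simp
  qed
  ultimately show "z * X_poly q t1 t2 t3 t4 (- int n) z =
          of_real (coeff_a q t1 t2 t3 t4 n) * X_poly q t1 t2 t3 t4 (- int n) z
          + of_real (coeff_b q t1 t2 t3 t4 n) * X_poly q t1 t2 t3 t4 (int n) z
          + of_real (coeff_c q t1 t2 t3 t4 n) * X_poly q t1 t2 t3 t4 (int n - 1) z"
    using fin unfolding a b c_def[symmetric] by (simp add: cs(9-11))
qed

section \<open>Extreme coefficients of the Laurent polynomials\<close>

text \<open>Multiplying by \<open>z\<^sup>-\<^sup>n\<close> and letting \<open>z\<close> or \<open>1/z\<close> tend to infinity extracts the two extreme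
  coefficients of a Laurent polynomial.\<close>

lemma tendsto_qpoch_leading:
  "((\<lambda>z. qpoch (a * z) q k / z ^ k) \<longlongrightarrow> (\<Prod>i<k. - a * of_real q ^ i)) at_infinity"
proof -
  have "((\<lambda>z. \<Prod>i<k. inverse z - a * of_real q ^ i) \<longlongrightarrow> (\<Prod>i<k. 0 - a * of_real q ^ i)) at_infinity"
    by (intro tendsto_intros tendsto_inverse_0)
  moreover have "\<forall>\<^sub>F z in at_infinity. (\<Prod>i<k. inverse z - a * of_real q ^ i) = qpoch (a * z) q k / z ^ k"
    using eventually_not_equal_at_infinity[of 0]
  proof eventually_elim
    case (elim z)
    have "qpoch (a * z) q k / z ^ k = (\<Prod>i<k. (1 - a * z * of_real q ^ i) / z)"
      by (simp add: qpoch_def prod_dividef)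
    also have "\<dots> = (\<Prod>i<k. inverse z - a * of_real q ^ i)"
      using elim by (intro prod.cong) (simp_all add: field_simps)
    finally show ?case by simp
  qed
  ultimately show ?thesis
    by (simp add: tendsto_cong)
qed

lemma tendsto_qpoch_1: "((\<lambda>z. qpoch (b / z) q k) \<longlongrightarrow> 1) at_infinity"
proof -
  have "((\<lambda>z. \<Prod>i<k. 1 - b * inverse z * of_real q ^ i) \<longlongrightarrow> (\<Prod>i<k. 1 - b * 0 * of_real q ^ i)) at_infinity"
    by (intro tendsto_intros tendsto_inverse_0)
  then show ?thesis by (simp add: qpoch_def divide_inverse)
qed

text \<open>The quotient splits into \<open>qpoch (a * z) q k / z ^ k\<close>, a factor tending to
  1, and \<open>inverse z ^ (n - k)\<close>, which tends to 0 unless \<open>k = n\<close>.\<close>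

lemma tendsto_qpoch_mult:
  assumes "k \<le> n"
  shows "((\<lambda>z. qpoch (a * z) q k * qpoch (b / z) q k / z ^ n) \<longlongrightarrow>
     (if k = n then \<Prod>i<n. - a * of_real q ^ i else 0)) at_infinity"
proof -
  have "((\<lambda>z. qpoch (a * z) q k / z ^ k * qpoch (b / z) q k * inverse z ^ (n - k)) \<longlongrightarrow>
     (\<Prod>i<k. - a * of_real q ^ i) * 1 * 0 ^ (n - k)) at_infinity"
    by (intro tendsto_intros tendsto_qpoch_leading tendsto_qpoch_1 tendsto_inverse_0)
  moreover have "(\<Prod>i<k. - a * of_real q ^ i) * 1 * 0 ^ (n - k) =
     (if k = n then \<Prod>i<n. - a * complex_of_real q ^ i else 0)"
    using assms by simp
  moreover have "qpoch (a * z) q k / z ^ k * qpoch (b / z) q k * inverse z ^ (n - k) =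
      qpoch (a * z) q k * qpoch (b / z) q k / z ^ n" for z
    using power_add[of z k "n - k"] assms by (simp add: field_simps)
  ultimately show ?thesis by simp
qed

text \<open>Only a term with index \<open>n\<close> reaches degree \<open>n\<close> in
  \<open>z\<close>, and it is present only if \<open>m = n\<close>, as the last one.\<close>

lemma tendsto_phi43_sum:
  assumes "m \<le> n"
  shows "((\<lambda>z. (\<Sum>k<Suc m. phi43_term a1 a2 (a * z) (b / z) b1 b2 b3 q k) / z ^ n) \<longlongrightarrow>
     (if m = n then phi43_term a1 a2 0 0 b1 b2 b3 q n * (\<Prod>i<n. - a * of_real q ^ i) else 0)) at_infinity"
proof -
  define f where "f = phi43_term a1 a2 0 0 b1 b2 b3 q"
  have f: "phi43_term a1 a2 x y b1 b2 b3 q k = f k * (qpoch x q k * qpoch y q k)" for x y k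
    by (simp add: f_def phi43_term_def qpoch_def)
  have "((\<lambda>z. \<Sum>k<Suc m. f k * (qpoch (a * z) q k * qpoch (b / z) q k / z ^ n)) \<longlongrightarrow>
     (\<Sum>k<Suc m. f k * (if k = n then \<Prod>i<n. - a * of_real q ^ i else 0))) at_infinity"
    using assms by (intro tendsto_sum tendsto_mult tendsto_const tendsto_qpoch_mult) auto
  moreover have "(\<Sum>k<Suc m. f k * (if k = n then \<Prod>i<n. - a * of_real q ^ i else 0)) =
     (if m = n then f n * (\<Prod>i<n. - a * of_real q ^ i) else 0)"
    using assms by (auto intro!: sum.neutral)
  ultimately show ?thesis
    unfolding f_def[symmetric] unfolding f by (simp add: sum_divide_distrib del: sum.lessThan_Suc)
qed

text \<open>The factors of (q^(-n);q)_n are 1 - q^(i-n) with i < n, so the zero factor at i = n is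
  just missed.\<close>

lemma phi43_term_0_nonzero:
  assumes "0 < q" "q < 1" "\<bar>a\<bar> < 1" "\<bar>b1\<bar> < 1" "\<bar>b2\<bar> < 1" "\<bar>b3\<bar> < 1"
  shows "phi43_term (of_real (q powi (- int n))) (of_real a) 0 0
     (of_real b1) (of_real b2) (of_real b3) q n \<noteq> 0"
proof -
  have "qpoch (of_real (q powi (- int n))) q n \<noteq> 0"
  proof
    assume "qpoch (of_real (q powi (- int n))) q n = 0"
    then obtain i where i: "i < n" "of_real (q powi (- int n) * q ^ i) = (1::complex)"
      by (auto simp: qpoch_eq_0_iff)
    from i(2) have "q powi (- int n) * q ^ i = 1"
      by (simp only: of_real_eq_1_iff)
    then have "q ^ i = q ^ n"
      using assms(1) by (simp add: power_int_minus field_simps)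
    with power_strict_decreasing[OF i(1) assms(1,2)] show False by simp
  qed
  then show ?thesis
    using assms by (simp add: phi43_term_def qpoch_of_real_nonzero) (simp add: qpoch_def)
qed

lemma tendsto_R_poly_lower:
  assumes "0 < q" "m < n"
  shows "((\<lambda>z. R_poly q t1 t2 t3 t4 m z / z ^ n) \<longlongrightarrow> 0) at_infinity"
  using tendsto_phi43_sum[of m n] assms
  by (simp add: R_poly_sum[of q m "Suc m"] del: sum.lessThan_Suc)

text \<open>As \<open>(0;q)\<^sub>k = 1\<close>, setting both \<open>z\<close>-dependent arguments of \<open>phi43_term\<close> to \<open>0\<close> isolates the
  coefficient that does not depend on \<open>z\<close>.\<close>

definition S_lead :: "real \<Rightarrow> real \<Rightarrow> real \<Rightarrow> real \<Rightarrow> real \<Rightarrow> nat \<Rightarrow> complex" where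
  "S_lead q t1 t2 t3 t4 n =
     phi43_term (of_real (q powi (- int (n - 1)))) (of_real (t1 * t2 * t3 * t4 * q ^ n)) 0 0
       (of_real (q * t1 * t2)) (of_real (q * t1 * t3)) (of_real (q * t1 * t4)) q (n - 1)
     * (\<Prod>i<n - 1. - of_real t1 * of_real q ^ i)"

text \<open>The prefactor behaves like \<open>z\<close> at infinity and like
  \<open>t3 * t4 / z\<close> at 0. Inversion makes \<open>q * t1\<close> instead of
  \<open>t1\<close> multiply the growing variable, and the \<open>n - 1\<close> factors of the
  leading product then contribute \<open>q ^ (n - 1)\<close>.\<close>

lemma tendsto_S_poly:
  assumes q: "0 < q" and m: "0 < m" "m \<le> n"
  shows "((\<lambda>z. S_poly q t1 t2 t3 t4 m z / z ^ n) \<longlongrightarrow>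
       (if m = n then S_lead q t1 t2 t3 t4 n else 0)) at_infinity" (is ?inf)
    and "((\<lambda>z. S_poly q t1 t2 t3 t4 m (inverse z) / z ^ n) \<longlongrightarrow>
       (if m = n then S_lead q t1 t2 t3 t4 n * of_real (t3 * t4 * q ^ (n - 1)) else 0)) at_infinity" (is ?zero)
proof -
  obtain k where k: "m = Suc k" using m by (cases m) auto
  obtain l where l: "n = Suc l" using m by (cases n) auto
  define t where "t x y = phi43_term (of_real (q powi (- int k))) (of_real (t1 * t2 * t3 * t4 * q ^ m)) x y
    (of_real (q * t1 * t2)) (of_real (q * t1 * t3)) (of_real (q * t1 * t4)) q" for x y
  define f where "f x y = (\<Sum>i<Suc k. t x y i)" for x y
  define lead where "lead a = (if k = l then t 0 0 l * (\<Prod>i<l. - a * of_real q ^ i) else 0)" for a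
  have S: "S_poly q t1 t2 t3 t4 m z = z * (1 - of_real t3 / z) * (1 - of_real t4 / z)
     * f (of_real t1 * z) (of_real (q * t1) / z)" for z
    using S_poly_sum[of q m "Suc k" t1 t2 t3 t4 z] q k by (simp add: f_def t_def)
  have lim: "((\<lambda>z. f (a * z) (b / z) / z ^ l) \<longlongrightarrow> lead a) at_infinity" for a b
    unfolding f_def t_def lead_def using m k l by (intro tendsto_phi43_sum) simp
  \<comment> \<open>This symmetry lets \<open>lim\<close> serve for both ends.\<close>
  have comm: "f x y = f y x" for x y
    by (simp add: f_def t_def phi43_term_def mult_ac)
  have lim_f: "((\<lambda>z. (1 - of_real t3 * inverse z) * (1 - of_real t4 * inverse z)
        * (f (of_real t1 * z) (of_real (q * t1) / z) / z ^ l)) \<longlongrightarrow>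
      (1 - of_real t3 * 0) * (1 - of_real t4 * 0) * lead (of_real t1)) at_infinity"
    by (intro tendsto_intros tendsto_inverse_0 lim)
  have eq: "(1 - of_real t3 * 0) * (1 - of_real t4 * 0) * lead (of_real t1)
      = (if m = n then S_lead q t1 t2 t3 t4 n else 0)"
    by (simp add: lead_def S_lead_def t_def k l)
  have ev: "\<forall>\<^sub>F z in at_infinity. (1 - of_real t3 * inverse z) * (1 - of_real t4 * inverse z)
        * (f (of_real t1 * z) (of_real (q * t1) / z) / z ^ l) = S_poly q t1 t2 t3 t4 m z / z ^ n"
    using eventually_not_equal_at_infinity[of 0]
    by eventually_elim (unfold S l, simp add: divide_inverse mult_ac)
  show ?inf
    using Lim_transform_eventually[OF lim_f ev] unfolding eq .
  have lim_f: "((\<lambda>z. (inverse z - of_real t3) * (inverse z - of_real t4)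
        * (f (of_real (q * t1) * z) (of_real t1 / z) / z ^ l)) \<longlongrightarrow>
      (0 - of_real t3) * (0 - of_real t4) * lead (of_real (q * t1))) at_infinity"
    by (intro tendsto_intros tendsto_inverse_0 lim)
  have eq: "(0 - of_real t3) * (0 - of_real t4) * lead (of_real (q * t1))
      = (if m = n then S_lead q t1 t2 t3 t4 n * of_real (t3 * t4 * q ^ (n - 1)) else 0)"
  proof -
    have "(\<Prod>i<l. - of_real (q * t1) * of_real q ^ i) =
        (\<Prod>i<l. complex_of_real q * (- of_real t1 * of_real q ^ i))"
      by (intro prod.cong) simp_all
    also have "\<dots> = complex_of_real (q ^ l) * (\<Prod>i<l. - of_real t1 * of_real q ^ i)"
      by (simp only: prod.distrib) simp
    finally show ?thesis
      unfolding lead_def S_lead_def t_def k l by simp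
  qed
  have ev: "\<forall>\<^sub>F z in at_infinity. (inverse z - of_real t3) * (inverse z - of_real t4)
        * (f (of_real (q * t1) * z) (of_real t1 / z) / z ^ l) = S_poly q t1 t2 t3 t4 m (inverse z) / z ^ n"
    using eventually_not_equal_at_infinity[of 0]
  proof eventually_elim
    case (elim z)
    have e: "(inverse z - of_real t3) * (inverse z - of_real t4)
        = inverse z * (1 - of_real t3 * z) * (1 - of_real t4 * z) * inverse z"
      using elim by (simp add: field_simps)
    have "S_poly q t1 t2 t3 t4 m (inverse z) = inverse z * (1 - of_real t3 * z) * (1 - of_real t4 * z)
        * f (of_real (q * t1) * z) (of_real t1 / z)"
      unfolding S comm[of "of_real t1 * inverse z"] by (simp add: divide_inverse)
    then show ?case
      unfolding e l by (simp add: divide_inverse mult_ac)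
  qed
  show ?zero
    using Lim_transform_eventually[OF lim_f ev] unfolding eq .
qed

lemma S_lead_nonzero:
  assumes q: "0 < q" "q < 1" and t: "\<bar>t1\<bar> < 1" "\<bar>t2\<bar> < 1" "\<bar>t3\<bar> < 1" "\<bar>t4\<bar> < 1"
    and "t1 \<noteq> 0"
  shows "S_lead q t1 t2 t3 t4 n \<noteq> 0"
proof -
  have "\<bar>q ^ n\<bar> \<le> 1" "\<bar>q\<bar> < 1"
    using q by (simp_all add: power_le_one)
  then show ?thesis
    unfolding S_lead_def mult_eq_0_iff de_Morgan_disj using assms
    by (intro conjI phi43_term_0_nonzero abs_mult_less_1) simp_all
qed

text \<open>Uniqueness needs only that the leading coefficient is nonzero, so its value stays
  hidden.\<close>

lemma R_poly_leading:
  assumes q: "0 < q" "q < 1" and t: "\<bar>t1\<bar> < 1" "\<bar>t2\<bar> < 1" "\<bar>t3\<bar> < 1" "\<bar>t4\<bar> < 1"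
    and "t1 \<noteq> 0" "n \<ge> 1"
  obtains r where "r \<noteq> 0" "((\<lambda>z. R_poly q t1 t2 t3 t4 n z / z ^ n) \<longlongrightarrow> r) at_infinity"
proof
  let ?c = "phi43_term (of_real (q powi (- int n))) (of_real (t1 * t2 * t3 * t4 * q powi (int n - 1)))
     0 0 (of_real (t1 * t2)) (of_real (t1 * t3)) (of_real (t1 * t4)) q n"
  let ?r = "?c * (\<Prod>i<n. - of_real t1 * of_real q ^ i)"
  show "((\<lambda>z. R_poly q t1 t2 t3 t4 n z / z ^ n) \<longlongrightarrow> ?r) at_infinity"
    using tendsto_phi43_sum[of n n] q
    by (simp add: R_poly_sum[of q n "Suc n"] del: sum.lessThan_Suc)
  have "\<bar>q powi (int n - 1)\<bar> \<le> 1"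
    using q \<open>n \<ge> 1\<close> by (simp add: power_int_def power_le_one)
  then have "?c \<noteq> 0"
    using q t by (intro phi43_term_0_nonzero abs_mult_less_1) (assumption | rule less_imp_le)+
  then show "?r \<noteq> 0"
    using q \<open>t1 \<noteq> 0\<close> by simp
qed

text \<open>Inversion swaps the arguments \<open>t1 * z\<close> and \<open>t1 / z\<close>, in which
  the series is symmetric.\<close>

lemma R_poly_inverse: "R_poly q t1 t2 t3 t4 n (inverse z) = R_poly q t1 t2 t3 t4 n z"
  by (simp add: R_poly_def phi43_def divide_inverse mult_ac)

text \<open>At this point the argument \<open>t1 * z\<close> is 1, and (1;q)_k = 0 for k > 0 reduces
  both series to their first term.\<close>

lemma X_poly_nonneg_at_inverse_t1:
  assumes "t1 \<noteq> 0"
  shows "X_poly q t1 t2 t3 t4 (int n) (1 / of_real t1) =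
     of_real ((1 - t1 * t3) * (1 - t1 * t4) * (1 - t1 * t2 * q ^ n))"
proof -
  have phi: "phi43 a b 1 c d e f q = 1" for a b c d e f
  proof -
    have "qpoch 1 q k = 0" if "k > 0" for k
      using that by (auto simp: qpoch_eq_0_iff intro!: exI[of _ 0])
    then have "phi43 a b 1 c d e f q = (\<Sum>k\<in>{0}. qpoch a q k * qpoch b q k * qpoch 1 q k * qpoch c q k /
      (qpoch (of_real q) q k * qpoch d q k * qpoch e q k * qpoch f q k) * of_real q ^ k)"
      unfolding phi43_def by (intro suminf_finite) auto
    then show ?thesis by simp
  qed
  show ?thesis
    using assms by (auto simp: X_poly_nonneg R_poly_def S_poly_def phi field_simps power2_eq_square)
qed

section \<open>Uniqueness of the coefficients\<close>

lemma three_term_relation_unique: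
  fixes q t1 t2 t3 t4 :: real and n :: nat
  assumes q: "0 < q" "q < 1"
    and t: "\<bar>t1\<bar> < 1" "\<bar>t2\<bar> < 1" "\<bar>t3\<bar> < 1" "\<bar>t4\<bar> < 1"
    and n: "n \<ge> 1"
    and E: "- 1 - t1 * t2 + t1 * t2 * t3 * t4 * q ^ (n - 1) + t1 * t2 * q ^ n \<noteq> 0"
    and t1: "t1 \<noteq> 0"
    and rel: "three_term_relation q t1 t2 t3 t4 n a b c" "three_term_relation q t1 t2 t3 t4 n a' b' c'"
  shows "a = a' \<and> b = b' \<and> c = c'"
proof -
  define x y w where "x = a - a'" and "y = b - b'" and "w = c - c'"
  obtain r where r: "r \<noteq> 0" "((\<lambda>z. R_poly q t1 t2 t3 t4 n z / z ^ n) \<longlongrightarrow> r) at_infinity"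
    using R_poly_leading[OF q t t1 n] .
  define A u v where "A = complex_of_real ((1 - t1 * t2) * (1 - t1 * t3) * (1 - t1 * t4))"
    and "u = complex_of_real (t1 * (1 - t1 * t2 * t3 * t4 * q ^ (n - 1)))"
    and "v = complex_of_real (t1\<^sup>2 * t2 * (1 - q ^ n))"
  have int_n: "int n - 1 = int (n - 1)" using n by simp
  have comb: "x * (A * R_poly q t1 t2 t3 t4 n z - u * S_poly q t1 t2 t3 t4 n z)
      + y * (A * R_poly q t1 t2 t3 t4 n z + v * S_poly q t1 t2 t3 t4 n z)
      + w * X_poly q t1 t2 t3 t4 (int (n - 1)) z = 0" if "z \<noteq> 0" for z
  proof -
    have "x * X_poly q t1 t2 t3 t4 (- int n) z + y * X_poly q t1 t2 t3 t4 (int n) z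
        + w * X_poly q t1 t2 t3 t4 (int n - 1) z = 0"
      using rel that unfolding three_term_relation_def x_def y_def w_def
      by (simp add: algebra_simps del: of_nat_diff)
    then show ?thesis
      unfolding int_n using n by (simp add: X_poly_neg X_poly_nonneg A_def u_def v_def)
  qed
  \<comment> \<open>With \<open>g\<close> the identity or inversion this treats both ends at once:
    \<open>R_poly\<close> is invariant under either, and only the limit \<open>\<sigma>\<close> of
    the S part changes.\<close>
  have extreme: "(x + y) * A * r + (y * v - x * u) * \<sigma> = 0"
    if lim: "((\<lambda>z. S_poly q t1 t2 t3 t4 n (g z) / z ^ n) \<longlongrightarrow> \<sigma>) at_infinity"
      "n \<noteq> 1 \<Longrightarrow> ((\<lambda>z. S_poly q t1 t2 t3 t4 (n - 1) (g z) / z ^ n) \<longlongrightarrow> 0) at_infinity"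
      and g: "\<And>m z. R_poly q t1 t2 t3 t4 m (g z) = R_poly q t1 t2 t3 t4 m z" "\<And>z. z \<noteq> 0 \<Longrightarrow> g z \<noteq> 0"
    for g :: "complex \<Rightarrow> complex" and \<sigma>
  proof -
    have lower: "((\<lambda>z. S_poly q t1 t2 t3 t4 (n - 1) (g z) / z ^ n) \<longlongrightarrow> 0) at_infinity"
      using lim(2) by (cases "n = 1") (simp add: S_poly_def, blast)
    have lowerR: "((\<lambda>z. R_poly q t1 t2 t3 t4 (n - 1) z / z ^ n) \<longlongrightarrow> 0) at_infinity"
      using q n by (intro tendsto_R_poly_lower) simp_all
    define v' where "v' = complex_of_real (t1\<^sup>2 * t2 * (1 - q ^ (n - 1)))"
    have "((\<lambda>z. (x + y) * A * (R_poly q t1 t2 t3 t4 n z / z ^ n)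
        + (y * v - x * u) * (S_poly q t1 t2 t3 t4 n (g z) / z ^ n)
        + w * (A * (R_poly q t1 t2 t3 t4 (n - 1) z / z ^ n)
          + v' * (S_poly q t1 t2 t3 t4 (n - 1) (g z) / z ^ n)))
        \<longlongrightarrow> (x + y) * A * r + (y * v - x * u) * \<sigma> + w * (A * 0 + v' * 0)) at_infinity"
      by (intro tendsto_intros r lim lower lowerR)
    moreover have "\<forall>\<^sub>F z in at_infinity. (x + y) * A * (R_poly q t1 t2 t3 t4 n z / z ^ n)
        + (y * v - x * u) * (S_poly q t1 t2 t3 t4 n (g z) / z ^ n)
        + w * (A * (R_poly q t1 t2 t3 t4 (n - 1) z / z ^ n)
          + v' * (S_poly q t1 t2 t3 t4 (n - 1) (g z) / z ^ n)) = 0"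
      using eventually_not_equal_at_infinity[of 0]
    proof eventually_elim
      case (elim z)
      have X: "X_poly q t1 t2 t3 t4 (int (n - 1)) (g z)
          = A * R_poly q t1 t2 t3 t4 (n - 1) z + v' * S_poly q t1 t2 t3 t4 (n - 1) (g z)"
        unfolding X_poly_nonneg A_def v'_def g(1) ..
      have "((x + y) * A * R_poly q t1 t2 t3 t4 n z + (y * v - x * u) * S_poly q t1 t2 t3 t4 n (g z)
          + w * (A * R_poly q t1 t2 t3 t4 (n - 1) z + v' * S_poly q t1 t2 t3 t4 (n - 1) (g z))) = 0"
        using comb[OF g(2)[OF elim]] unfolding X g(1) by (simp add: algebra_simps)
      then have "((x + y) * A * R_poly q t1 t2 t3 t4 n z + (y * v - x * u) * S_poly q t1 t2 t3 t4 n (g z)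
          + w * (A * R_poly q t1 t2 t3 t4 (n - 1) z + v' * S_poly q t1 t2 t3 t4 (n - 1) (g z))) / z ^ n = 0"
        by simp
      then show ?case
        by (simp add: add_divide_distrib distrib_left)
    qed
    ultimately have "((\<lambda>z::complex. 0) \<longlongrightarrow> (x + y) * A * r + (y * v - x * u) * \<sigma> + w * (A * 0 + v' * 0)) at_infinity"
      by (rule Lim_transform_eventually)
    then show ?thesis
      using tendsto_unique[OF trivial_limit_at_infinity _ tendsto_const] by fastforce
  qed
  define s where "s = S_lead q t1 t2 t3 t4 n"
  have s: "s \<noteq> 0"
    using S_lead_nonzero[OF q t t1] by (simp add: s_def)
  have low: "0 < n - 1" "n - 1 \<le> n" "n - 1 \<noteq> n" if "n \<noteq> 1"
    using n that by auto
  have e1: "(x + y) * A * r + (y * v - x * u) * s = 0"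
  proof (rule extreme[of "\<lambda>z. z"])
    show "((\<lambda>z. S_poly q t1 t2 t3 t4 n z / z ^ n) \<longlongrightarrow> s) at_infinity"
      using tendsto_S_poly(1)[OF q(1), of n n t1 t2 t3 t4] n by (simp add: s_def)
    show "((\<lambda>z. S_poly q t1 t2 t3 t4 (n - 1) z / z ^ n) \<longlongrightarrow> 0) at_infinity" if "n \<noteq> 1"
      using tendsto_S_poly(1)[OF q(1) low(1,2), OF that that, of t1 t2 t3 t4]
      unfolding if_not_P[OF low(3)[OF that]] .
  qed simp_all
  have e2: "(x + y) * A * r + (y * v - x * u) * (s * of_real (t3 * t4 * q ^ (n - 1))) = 0"
  proof (rule extreme[of inverse])
    show "((\<lambda>z. S_poly q t1 t2 t3 t4 n (inverse z) / z ^ n) \<longlongrightarrow>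
        s * of_real (t3 * t4 * q ^ (n - 1))) at_infinity"
      using tendsto_S_poly(2)[OF q(1), of n n t1 t2 t3 t4] n by (simp add: s_def)
    show "((\<lambda>z. S_poly q t1 t2 t3 t4 (n - 1) (inverse z) / z ^ n) \<longlongrightarrow> 0) at_infinity" if "n \<noteq> 1"
      using tendsto_S_poly(2)[OF q(1) low(1,2), OF that that, of t1 t2 t3 t4]
      unfolding if_not_P[OF low(3)[OF that]] .
  qed (simp_all add: R_poly_inverse)
  have small: "1 - a1 * a2 * q ^ k \<noteq> 0" if "\<bar>a1\<bar> < 1" "\<bar>a2\<bar> < 1" for a1 a2 k
    using abs_mult_less_1[of "a1 * a2" "q ^ k"] abs_mult_less_1[of a1 a2] q that
    by (auto simp: power_le_one)
  have "complex_of_real (1 - t3 * t4 * q ^ (n - 1)) \<noteq> 0"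
    using small[OF t(3,4)] by (simp only: of_real_eq_0_iff not_False_eq_True)
  \<comment> \<open>Subtracting \<open>e2\<close> from \<open>e1\<close> removes the R contribution,
    which is the same at both ends.\<close>
  moreover have "(y * v - x * u) * s * complex_of_real (1 - t3 * t4 * q ^ (n - 1)) = 0"
    using e1 e2 unfolding of_real_diff of_real_1 by algebra
  ultimately have yx: "y * v = x * u"
    using s by simp
  have "A \<noteq> 0"
    using small[of _ _ 0] t unfolding A_def of_real_eq_0_iff by simp
  with e1 yx r have "y = - x"
    by (simp add: add_eq_0_iff)
  with yx have "x * (u + v) = 0"
    by algebra
  \<comment> \<open>The sum is \<open>- t1\<close> times the denominator factor assumed
    nonzero.\<close>
  moreover have "u + v \<noteq> 0"
  proof -
    have "q ^ n = q * q ^ (n - 1)" using n by (cases n) simp_all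
    then have "u + v = of_real (- t1 * (- 1 - t1 * t2 + t1 * t2 * t3 * t4 * q ^ (n - 1) + t1 * t2 * q ^ n))"
      unfolding u_def v_def of_real_add[symmetric] of_real_eq_iff
      by (simp add: algebra_simps power2_eq_square)
    with E t1 show ?thesis by (simp only: of_real_eq_0_iff mult_eq_0_iff neg_equal_0_iff_equal) simp
  qed
  ultimately have "x = 0" by simp
  with \<open>y = - x\<close> have "y = 0" by simp
  \<comment> \<open>Only the third term is left, and evaluation at a point where its polynomial is
    nonzero settles \<open>w\<close>.\<close>
  have "w * X_poly q t1 t2 t3 t4 (int (n - 1)) (1 / of_real t1) = 0"
    using comb[of "1 / of_real t1"] t1 \<open>x = 0\<close> \<open>y = 0\<close> by simp
  moreover have "X_poly q t1 t2 t3 t4 (int (n - 1)) (1 / of_real t1) \<noteq> 0"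
    using small[of _ _ 0] small t unfolding X_poly_nonneg_at_inverse_t1[OF t1] of_real_eq_0_iff by simp
  ultimately have "w = 0" by simp
  with \<open>x = 0\<close> \<open>y = 0\<close> show ?thesis
    by (simp add: x_def y_def w_def)
qed

theorem proposition4p7:
  fixes q t1 t2 t3 t4 :: real and n :: nat
  assumes "0 < q" and "q < 1"
    and "\<bar>t1\<bar> < 1" and "\<bar>t2\<bar> < 1" and "\<bar>t3\<bar> < 1" and "\<bar>t4\<bar> < 1"
    and "n \<ge> 1"
    and "- 1 - t1 * t2 + t1 * t2 * t3 * t4 * q ^ (n - 1) + t1 * t2 * q ^ n \<noteq> 0"
  shows "three_term_relation q t1 t2 t3 t4 n
           (of_real (coeff_a q t1 t2 t3 t4 n)) (of_real (coeff_b q t1 t2 t3 t4 n))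
           (of_real (coeff_c q t1 t2 t3 t4 n))
         \<and> (t1 \<noteq> 0 \<longrightarrow>
             (\<forall>a b c. three_term_relation q t1 t2 t3 t4 n a b c \<longrightarrow>
                a = of_real (coeff_a q t1 t2 t3 t4 n) \<and>
                b = of_real (coeff_b q t1 t2 t3 t4 n) \<and>
                c = of_real (coeff_c q t1 t2 t3 t4 n)))"
  using three_term_relation_coeffs[OF assms(1-8)] three_term_relation_unique[OF assms(1-8)]
  by blast

end
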